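(* Let $p$ be a prime, $S$ a finite $p$-group, and $G$ a finite group satisfying: (a) $S$ is a Sylow $p$-subgroup of $G$; (b) $C_G(O_p(G))\leq O_p(G)$; (c) $G$ acts (by conjugation) $p$-stably on every normal $p$-subgroup of $G$. Let $D\trianglelefteq S$ be strongly closed in $S$ with respect to $G$. Let $\mathcal{A}$ be a set of abelian subgroups of $D$ which is complete in $D$ and satisfies replacement in $S$. Then $I_{\mathcal{A}}\trianglelefteq G$.
   Context: All groups are finite. For a set $\mathcal{A}$ of abelian subgroups of a $p$-group, $I_{\mathcal{A}}:=\bigcap_{A\in\mathcal{A}}A$, with $I_{\mathcal{A}}=1$ if $\mathcal{A}=\emptyset$. $D\trianglelefteq S$ is strongly closed in $S$ with respect to $G\geq S$ if the only elements of $S$ which are $G$-conjugate to elements of $D$ are the elements of $D$. $\mathcal{A}$ is complete in $D$ if it contains every subgroup of $D$ that is isomorphic to a member of $\mathcal{A}$. $\mathcal{A}$ satisfies replacement in $S$ if: for every $B\trianglelefteq S$ of nilpotency class $\leq 2$, if there exist members of $\mathcal{A}$ that contain $[B,B]$ but do not contain $B$, then $B$ normalizes one of them (that is, $B$ normalizes some member of $\mathcal{A}$ that contains $[B,B]$ but not $B$). $O_p(G)$ is the largest normal $p$-subgroup of $G$. If $G$ acts on a $p$-group $P$, then $O_p(G\curvearrowright P)\trianglelefteq G$ denotes the preimage of $O_p(G/C_G(P))$ under the natural map $G\to G/C_G(P)$. An element $x\in G$ acts quadratically on $P$ if $[P,x,x]=1$, where $[P,x,x]=[[P,x],x]$ and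 commutators are $[w,x]=w^{-1}x^{-1}wx$ (in $P\rtimes G$). The action of $G$ on $P$ is $p$-stable if every element of $G$ that acts quadratically on $P$ lies in $O_p(G\curvearrowright P)$. *)

theory Defs
  imports "HOL-Algebra.Algebra"
begin

definition p_group :: "nat \<Rightarrow> ('a, 'b) monoid_scheme \<Rightarrow> bool" where
  "p_group p G \<longleftrightarrow> group G \<and> finite (carrier G) \<and> (\<exists>n. order G = p ^ n)"

definition sylow_subgroup :: "nat \<Rightarrow> ('a, 'b) monoid_scheme \<Rightarrow> 'a set \<Rightarrow> bool" where
  "sylow_subgroup p G S \<longleftrightarrow> subgroup S G \<and> card S = p ^ multiplicity p (order G)"

definition normal_p_subgroup :: "nat \<Rightarrow> ('a, 'b) monoid_scheme \<Rightarrow> 'a set \<Rightarrow> bool" where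
  "normal_p_subgroup p G N \<longleftrightarrow> N \<lhd> G \<and> p_group p (G\<lparr>carrier := N\<rparr>)"

(* O_p(G); "largest" is with respect to inclusion, and p_core_greatest below shows
   that the largest element exists when G is finite and p is prime. *)
definition p_core :: "nat \<Rightarrow> ('a, 'b) monoid_scheme \<Rightarrow> 'a set" where
  "p_core p G = (GREATEST N. normal_p_subgroup p G N)"

definition centralizer :: "('a, 'b) monoid_scheme \<Rightarrow> 'a set \<Rightarrow> 'a set" where
  "centralizer G H = {g \<in> carrier G. \<forall>h\<in>H. g \<otimes>\<^bsub>G\<^esub> h = h \<otimes>\<^bsub>G\<^esub> g}"

(* An action of G on a group P is a homomorphism \<phi> from G to AutoGroup P, so \<phi> g is a left
   action. In the semidirect product of P by G one has x w x^-1 = \<phi> x w, whence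
   [w, x] = w^-1 (x^-1 w x) = w^-1 (\<phi> (x^-1) w), an element of P. *)
definition action_commutator ::
  "('g, 'c) monoid_scheme \<Rightarrow> ('a, 'b) monoid_scheme \<Rightarrow> ('g \<Rightarrow> 'a \<Rightarrow> 'a) \<Rightarrow> 'a set \<Rightarrow> 'g \<Rightarrow> 'a set"
  where
  "action_commutator G P \<phi> W x =
     generate P {inv\<^bsub>P\<^esub> w \<otimes>\<^bsub>P\<^esub> \<phi> (inv\<^bsub>G\<^esub> x) w | w. w \<in> W}"

definition acts_quadratically ::
  "('g, 'c) monoid_scheme \<Rightarrow> ('a, 'b) monoid_scheme \<Rightarrow> ('g \<Rightarrow> 'a \<Rightarrow> 'a) \<Rightarrow> 'g \<Rightarrow> bool" where
  "acts_quadratically G P \<phi> x \<longleftrightarrow>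
     action_commutator G P \<phi> (action_commutator G P \<phi> (carrier P) x) x = {\<one>\<^bsub>P\<^esub>}"

(* The preimage in G of O_p(G / C_G(P)), where C_G(P) is the kernel of the action. *)
definition p_core_action ::
  "nat \<Rightarrow> ('g, 'c) monoid_scheme \<Rightarrow> ('a, 'b) monoid_scheme \<Rightarrow> ('g \<Rightarrow> 'a \<Rightarrow> 'a) \<Rightarrow> 'g set" where
  "p_core_action p G P \<phi> =
     {g \<in> carrier G. kernel G (AutoGroup P) \<phi> #>\<^bsub>G\<^esub> g \<in> p_core p (G Mod kernel G (AutoGroup P) \<phi>)}"

definition p_stable_action ::
  "nat \<Rightarrow> ('g, 'c) monoid_scheme \<Rightarrow> ('a, 'b) monoid_scheme \<Rightarrow> ('g \<Rightarrow> 'a \<Rightarrow> 'a) \<Rightarrow> bool" where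
  "p_stable_action p G P \<phi> \<longleftrightarrow>
     (\<forall>x\<in>carrier G. acts_quadratically G P \<phi> x \<longrightarrow> x \<in> p_core_action p G P \<phi>)"

definition conj_action :: "('a, 'b) monoid_scheme \<Rightarrow> 'a set \<Rightarrow> 'a \<Rightarrow> 'a \<Rightarrow> 'a" where
  "conj_action G P g = (\<lambda>w\<in>P. g \<otimes>\<^bsub>G\<^esub> w \<otimes>\<^bsub>G\<^esub> inv\<^bsub>G\<^esub> g)"

definition commutator_subgroup ::
  "('a, 'b) monoid_scheme \<Rightarrow> 'a set \<Rightarrow> 'a set \<Rightarrow> 'a set" where
  "commutator_subgroup G H K =
     generate G {inv\<^bsub>G\<^esub> h \<otimes>\<^bsub>G\<^esub> inv\<^bsub>G\<^esub> k \<otimes>\<^bsub>G\<^esub> h \<otimes>\<^bsub>G\<^esub> k | h k. h \<in> H \<and> k \<in> K}"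

(* Indexed from 0: lower_central G H 0 is the term usually written gamma_1(H). *)
primrec lower_central :: "('a, 'b) monoid_scheme \<Rightarrow> 'a set \<Rightarrow> nat \<Rightarrow> 'a set" where
  "lower_central G H 0 = H"
| "lower_central G H (Suc n) = commutator_subgroup G (lower_central G H n) H"

definition nilpotency_class_le :: "('a, 'b) monoid_scheme \<Rightarrow> 'a set \<Rightarrow> nat \<Rightarrow> bool" where
  "nilpotency_class_le G H c \<longleftrightarrow> lower_central G H c = {\<one>\<^bsub>G\<^esub>}"

definition strongly_closed :: "('a, 'b) monoid_scheme \<Rightarrow> 'a set \<Rightarrow> 'a set \<Rightarrow> bool" where
  "strongly_closed G S D \<longleftrightarrow>
     D \<lhd> G\<lparr>carrier := S\<rparr> \<and>
     (\<forall>d\<in>D. \<forall>g\<in>carrier G. inv\<^bsub>G\<^esub> g \<otimes>\<^bsub>G\<^esub> d \<otimes>\<^bsub>G\<^esub> g \<in> S \<longrightarrow> inv\<^bsub>G\<^esub> g \<otimes>\<^bsub>G\<^esub> d \<otimes>\<^bsub>G\<^esub> g \<in> D)"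

definition complete_in :: "('a, 'b) monoid_scheme \<Rightarrow> 'a set set \<Rightarrow> 'a set \<Rightarrow> bool" where
  "complete_in G \<A> D \<longleftrightarrow>
     (\<forall>H. subgroup H (G\<lparr>carrier := D\<rparr>) \<and>
          (\<exists>A\<in>\<A>. G\<lparr>carrier := H\<rparr> \<cong> G\<lparr>carrier := A\<rparr>) \<longrightarrow> H \<in> \<A>)"

definition satisfies_replacement :: "('a, 'b) monoid_scheme \<Rightarrow> 'a set set \<Rightarrow> 'a set \<Rightarrow> bool" where
  "satisfies_replacement G \<A> S \<longleftrightarrow>
     (\<forall>B. B \<lhd> G\<lparr>carrier := S\<rparr> \<and> nilpotency_class_le G B 2 \<and>
          (\<exists>A\<in>\<A>. commutator_subgroup G B B \<subseteq> A \<and> \<not> B \<subseteq> A) \<longrightarrow>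
        (\<exists>A\<in>\<A>. commutator_subgroup G B B \<subseteq> A \<and> \<not> B \<subseteq> A \<and> B \<subseteq> normalizer G A))"

(* I_A; the case split matters because \<Inter>{} = UNIV. *)
definition inter_family :: "('a, 'b) monoid_scheme \<Rightarrow> 'a set set \<Rightarrow> 'a set" where
  "inter_family G \<A> = (if \<A> = {} then {\<one>\<^bsub>G\<^esub>} else \<Inter>\<A>)"

lemma (in group) conj_mult:
  assumes "g \<in> carrier G" "x \<in> carrier G" "y \<in> carrier G"
  shows "g \<otimes> (x \<otimes> y) \<otimes> inv g = (g \<otimes> x \<otimes> inv g) \<otimes> (g \<otimes> y \<otimes> inv g)"
proof -
  have "(g \<otimes> x \<otimes> inv g) \<otimes> (g \<otimes> y \<otimes> inv g) = g \<otimes> x \<otimes> (inv g \<otimes> g) \<otimes> (y \<otimes> inv g)"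
    using assms by (simp only: m_assoc m_closed inv_closed)
  also have "\<dots> = g \<otimes> (x \<otimes> y) \<otimes> inv g"
    using assms by (simp add: m_assoc)
  finally show ?thesis by simp
qed

lemma (in group) conj_inverse:
  assumes "g \<in> carrier G" "x \<in> carrier G"
  shows "inv g \<otimes> (g \<otimes> x \<otimes> inv g) \<otimes> g = x"
proof -
  have "inv g \<otimes> (g \<otimes> x \<otimes> inv g) \<otimes> g = (inv g \<otimes> g) \<otimes> x \<otimes> (inv g \<otimes> g)"
    using assms by (simp only: m_assoc m_closed inv_closed)
  then show ?thesis using assms by simp
qed

lemma (in group) normal_p_subgroup_mult:
  assumes fin: "finite (carrier G)" and p: "Factorial_Ring.prime p"
    and M: "normal_p_subgroup p G M" and N: "normal_p_subgroup p G N"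
  shows "normal_p_subgroup p G (M <#> N)"
proof -
  have Mn: "M \<lhd> G" and Nn: "N \<lhd> G"
    using M N by (auto simp: normal_p_subgroup_def)
  have Ms: "subgroup M G" and Ns: "subgroup N G"
    using Mn Nn by (auto intro: normal_imp_subgroup)
  have sub: "subgroup (M <#> N) G"
    using mult_norm_subgroup[OF Mn Ns] .
  have nor: "M <#> N \<lhd> G"
  proof -
    have "g \<otimes> x \<otimes> inv g \<in> M <#> N" if g: "g \<in> carrier G" and x: "x \<in> M <#> N" for g x
    proof -
      obtain m n where mn: "m \<in> M" "n \<in> N" "x = m \<otimes> n"
        using x by (auto simp: set_mult_def)
      have c: "m \<in> carrier G" "n \<in> carrier G"
        using mn Ms Ns subgroup.mem_carrier by fast+
      have "g \<otimes> m \<otimes> inv g \<in> M" "g \<otimes> n \<otimes> inv g \<in> N"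
        using Mn Nn mn g by (auto simp: normal_inv_iff)
      moreover have "g \<otimes> x \<otimes> inv g = (g \<otimes> m \<otimes> inv g) \<otimes> (g \<otimes> n \<otimes> inv g)"
        using g c mn by (simp add: conj_mult)
      ultimately show ?thesis
        by (auto simp: set_mult_def)
    qed
    then show ?thesis
      using sub by (simp add: normal_inv_iff)
  qed
  obtain a b where ab: "card M = p ^ a" "card N = p ^ b"
    using M N by (auto simp: normal_p_subgroup_def p_group_def order_def)
  have finMN: "finite (M <#> N)"
    using finite_subset[OF subgroup.subset[OF sub] fin] .
  interpret S: second_isomorphism_grp M G N
    using Mn Ns by (simp add: second_isomorphism_grp_def second_isomorphism_grp_axioms_def)
  let ?Q = "(G\<lparr>carrier := M <#> N\<rparr>) Mod M"
  let ?R = "(G\<lparr>carrier := N\<rparr>) Mod (M \<inter> N)"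
  have sq: "order ?Q = order ?R"
    using S.normal_intersection_quotient_isom unfolding iso_def order_def
    by (auto dest: bij_betw_same_card)
  have gMN: "group (G\<lparr>carrier := M <#> N\<rparr>)" and gN: "group (G\<lparr>carrier := N\<rparr>)"
    using sub Ns by (auto intro: subgroup_imp_group)
  have sM: "subgroup M (G\<lparr>carrier := M <#> N\<rparr>)"
    using Ms sub S.H_contained_in_set_mult by (auto intro: subgroup_incl)
  have sI: "subgroup (M \<inter> N) (G\<lparr>carrier := N\<rparr>)"
    using Ms Ns by (auto intro: subgroup_incl subgroups_Inter_pair)
  have "card (M <#> N) = order ?Q * card M"
    using group.lagrange[OF gMN sM] by (simp add: order_def FactGroup_def mult.commute)
  moreover have "order ?R dvd card N"
  proof -
    have "card N = order ?R * card (M \<inter> N)"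
      using group.lagrange[OF gN sI] by (simp add: order_def FactGroup_def mult.commute)
    then show ?thesis by (rule dvdI)
  qed
  ultimately have "card (M <#> N) dvd p ^ (b + a)"
    using ab sq mult_dvd_mono[of "order ?R" "card N" "card M" "card M"]
    by (simp add: power_add)
  then obtain k where "card (M <#> N) = p ^ k"
    using divides_primepow_nat[OF p] by blast
  then show ?thesis
    using nor gMN finMN by (auto simp: normal_p_subgroup_def p_group_def order_def)
qed

lemma (in group) p_core_greatest:
  assumes fin: "finite (carrier G)" and p: "Factorial_Ring.prime p"
  shows "normal_p_subgroup p G (p_core p G)"
    and "normal_p_subgroup p G N \<Longrightarrow> N \<subseteq> p_core p G"
proof -
  let ?F = "{N. normal_p_subgroup p G N}"
  have "?F \<subseteq> Pow (carrier G)"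
    by (auto simp: normal_p_subgroup_def dest!: normal_imp_subgroup subgroup.subset)
  then have finF: "finite ?F"
    using fin finite_subset by blast
  have "normal_p_subgroup p G {\<one>}"
    using one_is_normal subgroup_imp_group[OF triv_subgroup]
    by (auto simp: normal_p_subgroup_def p_group_def order_def intro: exI[of _ 0])
  then obtain N where N: "normal_p_subgroup p G N"
    and max: "\<And>M. normal_p_subgroup p G M \<Longrightarrow> N \<subseteq> M \<Longrightarrow> M = N"
    using finite_has_maximal[OF finF] by (metis empty_iff mem_Collect_eq)
  have top: "M \<subseteq> N" if M: "normal_p_subgroup p G M" for M
  proof -
    interpret S: second_isomorphism_grp M G N
      using M N by (auto simp: second_isomorphism_grp_def second_isomorphism_grp_axioms_def
          normal_p_subgroup_def intro: normal_imp_subgroup)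
    show ?thesis
      using max[OF normal_p_subgroup_mult[OF fin p M N]]
        S.S_contained_in_set_mult S.H_contained_in_set_mult by auto
  qed
  have "p_core p G = N"
    unfolding p_core_def using N top by (intro Greatest_equality) auto
  then show "normal_p_subgroup p G (p_core p G)"
    and "normal_p_subgroup p G N' \<Longrightarrow> N' \<subseteq> p_core p G" for N'
    using N top by auto
qed

lemma (in group) conj_action_hom:
  assumes P: "P \<lhd> G"
  shows "conj_action G P \<in> hom G (AutoGroup (G\<lparr>carrier := P\<rparr>))"
proof -
  have Ps: "subgroup P G" using P by (rule normal_imp_subgroup)
  have car: "w \<in> P \<Longrightarrow> w \<in> carrier G" for w
    using Ps subgroup.mem_carrier by fast
  have cl: "g \<in> carrier G \<Longrightarrow> w \<in> P \<Longrightarrow> g \<otimes> w \<otimes> inv g \<in> P" for g w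
    using P by (auto simp: normal_inv_iff)
  have cl': "g \<in> carrier G \<Longrightarrow> w \<in> P \<Longrightarrow> inv g \<otimes> w \<otimes> g \<in> P" for g w
    using cl[of "inv g" w] by simp
  have mul: "g \<otimes> h \<otimes> w \<otimes> inv (g \<otimes> h) = g \<otimes> (h \<otimes> w \<otimes> inv h) \<otimes> inv g"
    if "g \<in> carrier G" "h \<in> carrier G" "w \<in> P" for g h w
    using that car by (simp add: m_assoc inv_mult_group)
  have bij: "bij_betw (\<lambda>w\<in>P. g \<otimes> w \<otimes> inv g) P P" if g: "g \<in> carrier G" for g
  proof (rule bij_betw_byWitness[where f' = "\<lambda>w. inv g \<otimes> w \<otimes> g"])
    show "\<forall>a\<in>P. inv g \<otimes> (\<lambda>w\<in>P. g \<otimes> w \<otimes> inv g) a \<otimes> g = a"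
      using g car by (simp add: conj_inverse)
    show "\<forall>a'\<in>P. (\<lambda>w\<in>P. g \<otimes> w \<otimes> inv g) (inv g \<otimes> a' \<otimes> g) = a'"
      using g car cl' conj_inverse[of "inv g"] by simp
  qed (use g cl cl' in auto)
  have Bij: "conj_action G P g \<in> Bij P" if "g \<in> carrier G" for g
    using bij[OF that] by (auto simp: Bij_def conj_action_def)
  have auto: "conj_action G P g \<in> auto (G\<lparr>carrier := P\<rparr>)" if g: "g \<in> carrier G" for g
  proof -
    have "g \<otimes> (x \<otimes> y) \<otimes> inv g = (g \<otimes> x \<otimes> inv g) \<otimes> (g \<otimes> y \<otimes> inv g)"
      if "x \<in> P" "y \<in> P" for x y
      using that car g by (simp add: conj_mult)
    then show ?thesis
      using Bij[OF g] g cl Ps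
      by (auto simp: auto_def hom_def conj_action_def subgroup.m_closed)
  qed
  have "conj_action G P (g \<otimes> h) = compose P (conj_action G P g) (conj_action G P h)"
    if "g \<in> carrier G" "h \<in> carrier G" for g h
    using that mul cl by (auto simp: conj_action_def compose_def fun_eq_iff)
  then show ?thesis
    using auto Bij by (auto simp: hom_def AutoGroup_def BijGroup_def)
qed

lemma (in group) commutator_subgroup_self:
  assumes "subgroup H G"
  shows "commutator_subgroup G H H = derived G H"
proof -
  have inv: "h \<in> H \<Longrightarrow> inv h \<in> H" and car: "h \<in> H \<Longrightarrow> h \<in> carrier G" for h
    using assms by (auto simp: subgroup.m_inv_closed subgroup.mem_carrier)
  have "{inv h \<otimes> inv k \<otimes> h \<otimes> k | h k. h \<in> H \<and> k \<in> H} = derived_set G H" (is "?L = ?R")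
  proof
    show "?L \<subseteq> ?R"
    proof
      fix x assume "x \<in> ?L"
      then obtain h k where hk: "h \<in> H" "k \<in> H" "x = inv h \<otimes> inv k \<otimes> h \<otimes> k" by blast
      then have "x = inv h \<otimes> inv k \<otimes> inv (inv h) \<otimes> inv (inv k)" using car by simp
      with hk inv show "x \<in> ?R" by blast
    qed
    show "?R \<subseteq> ?L"
    proof
      fix x assume "x \<in> ?R"
      then obtain h k where hk: "h \<in> H" "k \<in> H" "x = h \<otimes> k \<otimes> inv h \<otimes> inv k" by blast
      then have "x = inv (inv h) \<otimes> inv (inv k) \<otimes> inv h \<otimes> inv k" using car by simp
      with hk inv show "x \<in> ?L" by blast
    qed
  qed
  then show ?thesis
    by (simp add: commutator_subgroup_def derived_def)
qed

end

(* Write Z for I_A; it is an abelian normal subgroup of S. Let B be a normal p-subgroup of G of least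
   order for which the intersection of Z and B is not normal in G. By minimality B is the normal
   closure of that intersection, B' < B, and the intersection of Z and B' is normal in G. Hence B'
   is contained in Z and centralized by B, so B has class at most 2. Replacement gives a member A
   of the family that is normalized by B and does not contain B. Then A acts quadratically on B, so
   p-stability puts A into L, the preimage of O_p(G/C_G(B)). The Frattini argument gives
   G = C_G(B) N_G(T) where T is the intersection of S and L. By strong closure N_G(T) normalizes the
   intersection E of D and L, so by completeness it also normalizes the intersection I of all members
   of the family contained in E. Thus the intersection of I and B is normal in G. It contains that of
   Z and B, hence it is B, which contradicts that A is one of the groups intersected in I.
   Finally Z acts quadratically on O_p(G), and C_G(O_p(G)) <= O_p(G) turns p-stability into
   Z <= O_p(G). *)
theory Submission
  imports Defs
begin

section \<open>Actions of groups of prime power order and Sylow conjugation\<close>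

text \<open>Orbit lengths divide \<open>p ^ k\<close>. Without a fixed point no orbit has length 1,
  so p divides every orbit length and hence their sum \<open>card E\<close>.\<close>

lemma (in group_action) prime_power_fixed_point:
  assumes fin: "finite E" and p: "Factorial_Ring.prime (p::nat)" and ord: "order G = p ^ k"
    and nd: "\<not> p dvd card E"
  shows "\<exists>x\<in>E. \<forall>g\<in>carrier G. \<phi> g x = x"
proof (rule ccontr)
  assume neg: "\<not> ?thesis"
  have part: "partition E (orbits G E \<phi>)" by (rule orbit_partition)
  have U: "\<Union>(orbits G E \<phi>) = E"
    using partition.partition_coverture[OF part] .
  interpret G: group G using group_hom by (simp add: group_hom_def)
  have "p dvd card c" if c_orb: "c \<in> orbits G E \<phi>" for c
  proof -
    obtain x where x: "x \<in> E" and c: "c = orbit G \<phi> x" using c_orb by (auto simp: orbits_def)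
    have "card c * card (stabilizer G \<phi> x) = p ^ k"
      using orbit_stabilizer_theorem[OF x] ord c by simp
    then have "card c dvd p ^ k" by (metis dvd_triv_left)
    then obtain i where i: "card c = p ^ i" using divides_primepow_nat[OF p] by blast
    have "i \<noteq> 0"
    proof
      assume "i = 0"
      then obtain y where y: "c = {y}" using i by (auto simp: card_1_singleton_iff)
      have "x \<in> c" using orbit_refl[OF x] c by simp
      then have "\<forall>g\<in>carrier G. \<phi> g x = x" using y c by (auto simp: orbit_def)
      then show False using neg x by blast
    qed
    then show ?thesis using i by simp
  qed
  moreover have "\<forall>c1\<in>orbits G E \<phi>. \<forall>c2\<in>orbits G E \<phi>. c1 \<noteq> c2 \<longrightarrow> c1 \<inter> c2 = {}"
    using disjoint_union by blast
  ultimately have "p dvd card (\<Union>(orbits G E \<phi>))"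
    using fin U by (intro dvd_partition) auto
  then show False using nd U by simp
qed

text \<open>The maps are restricted to \<open>lcosets H\<close> because the elements of
  \<open>BijGroup\<close> are extensional functions.\<close>

lemma (in group) left_mult_action:
  assumes H: "subgroup H G"
  shows "group_action G (lcosets H) (\<lambda>g. \<lambda>C\<in>lcosets H. g <# C)"
proof -
  have sub: "C \<subseteq> carrier G" if "C \<in> lcosets H" for C
    using that subgroup.lcosets_carrier[OF H is_group] by blast
  have cl: "g <# C \<in> lcosets H" if "g \<in> carrier G" "C \<in> lcosets H" for g C
    using that lcos_m_assoc[OF subgroup.subset[OF H]] by (auto simp: LCOSETS_def)
  have Bij: "(\<lambda>C\<in>lcosets H. g <# C) \<in> Bij (lcosets H)" if g: "g \<in> carrier G" for g
  proof -
    have "bij_betw (\<lambda>C\<in>lcosets H. g <# C) (lcosets H) (lcosets H)"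
      by (rule bij_betw_byWitness[where f' = "\<lambda>C. inv g <# C"])
        (use g cl sub in \<open>auto simp: lcos_m_assoc lcos_mult_one\<close>)
    then show ?thesis by (auto simp: Bij_def)
  qed
  have "(\<lambda>C\<in>lcosets H. (g \<otimes> h) <# C) =
      compose (lcosets H) (\<lambda>C\<in>lcosets H. g <# C) (\<lambda>C\<in>lcosets H. h <# C)"
    if "g \<in> carrier G" "h \<in> carrier G" for g h
    using that cl sub by (auto simp: compose_def fun_eq_iff lcos_m_assoc)
  then show ?thesis
    unfolding group_action_def group_hom_def group_hom_axioms_def hom_def
    using Bij is_group group_BijGroup by (auto simp: BijGroup_def)
qed

text \<open>P acts by left multiplication on the m left cosets of T. As p does not divide m, some
  coset gT is fixed, and xgT = gT says that the conjugate of x by g lies in T. T may be any subgroup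
  of index prime to p.\<close>

lemma (in group) p_subgroup_conj_into:
  assumes fin: "finite (carrier G)" and p: "Factorial_Ring.prime p"
    and P: "subgroup P G" "card P = p ^ k"
    and T: "subgroup T G" and m: "order G = card T * m" "\<not> p dvd m"
  shows "\<exists>g\<in>carrier G. \<forall>x\<in>P. inv g \<otimes> x \<otimes> g \<in> T"
proof -
  interpret A: group_action "G\<lparr>carrier := P\<rparr>" "lcosets T" "\<lambda>g. \<lambda>C\<in>lcosets T. g <# C"
    using group_action.induced_action[OF left_mult_action[OF T] P(1)] .
  have "card T \<noteq> 0"
    using T fin by (metis card_eq_0_iff empty_iff finite_subset subgroup.one_closed subgroup.subset)
  then have "card (lcosets T) = m"
    using l_lagrange[OF fin T] m by (simp add: mult.commute)
  moreover have "finite (lcosets T)"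
    using fin by (simp add: LCOSETS_def)
  ultimately obtain C where C: "C \<in> lcosets T" and "\<forall>x\<in>P. x <# C = C"
    using A.prime_power_fixed_point[of p k] p P(2) m(2) by (auto simp: order_def)
  moreover from C obtain g where g: "g \<in> carrier G" "C = g <# T" by (auto simp: LCOSETS_def)
  ultimately have fixed: "x <# (g <# T) = g <# T" if "x \<in> P" for x using that by simp
  have "inv g \<otimes> x \<otimes> g \<in> T" if x: "x \<in> P" for x
  proof -
    have xc: "x \<in> carrier G" using x P(1) by (rule subgroup.mem_carrier[rotated])
    have "x \<otimes> g \<in> x <# (g <# T)"
      using lcos_self[OF g(1) T] by (auto simp: l_coset_def[of _ x])
    then have "x \<otimes> g \<in> g <# T" using fixed[OF x] by simp
    then show ?thesis
      using subgroup.lcos_module_imp[OF T is_group g(1)] g xc by (simp add: m_assoc)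
  qed
  then show ?thesis using g by blast
qed


section \<open>Sylow subgroups of normal subgroups and the Frattini argument\<close>

text \<open>Together with \<open>m_assoc\<close> and \<open>inv_mult_group\<close> these rewrite
  rules prove the word identities below: products are bracketed to the right, and adjacent inverses
  then cancel.\<close>

lemma (in group) cancel_inv:
  assumes "x \<in> carrier G" "y \<in> carrier G"
  shows "x \<otimes> (inv x \<otimes> y) = y" and "inv x \<otimes> (x \<otimes> y) = y"
  using assms by (simp_all flip: m_assoc)

lemma (in group) conj_closed_iff:
  assumes "N \<lhd> G" "g \<in> carrier G" "x \<in> carrier G"
  shows "g \<otimes> x \<otimes> inv g \<in> N \<longleftrightarrow> x \<in> N" and "inv g \<otimes> x \<otimes> g \<in> N \<longleftrightarrow> x \<in> N"
proof -
  have n: "h \<otimes> y \<otimes> inv h \<in> N" if "h \<in> carrier G" "y \<in> N" for h y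
    using assms(1) that by (simp add: normal_inv_iff)
  show "g \<otimes> x \<otimes> inv g \<in> N \<longleftrightarrow> x \<in> N"
    using n[of g x] n[of "inv g" "g \<otimes> x \<otimes> inv g"] assms conj_inverse[of g x] by auto
  show "inv g \<otimes> x \<otimes> g \<in> N \<longleftrightarrow> x \<in> N"
    using n[of g "inv g \<otimes> x \<otimes> g"] n[of "inv g" x] assms conj_inverse[of "inv g" x] by auto
qed

lemma (in group) sylow_index:
  assumes fin: "finite (carrier G)" and p: "Factorial_Ring.prime p" and S: "sylow_subgroup p G S"
  obtains m where "order G = card S * m" "\<not> p dvd m"
proof -
  have n: "order G \<noteq> 0" using order_gt_0_iff_finite fin by auto
  have "\<not> is_unit p" using p not_prime_unit by blast
  then obtain m where "order G = p ^ multiplicity p (order G) * m" "\<not> p dvd m"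
    using multiplicity_decompose'[OF n] by blast
  then show thesis using that[of m] S by (simp add: sylow_subgroup_def)
qed

text \<open>Some conjugate of N lies in S, and N coincides with each of its conjugates.\<close>

lemma (in group) normal_p_subgroup_le_sylow:
  assumes fin: "finite (carrier G)" and p: "Factorial_Ring.prime p" and S: "sylow_subgroup p G S"
    and N: "normal_p_subgroup p G N"
  shows "N \<subseteq> S"
proof
  fix x assume x: "x \<in> N"
  have Nn: "N \<lhd> G" and sub: "subgroup N G"
    using N by (auto simp: normal_p_subgroup_def intro: normal_imp_subgroup)
  obtain k where k: "card N = p ^ k"
    using N by (auto simp: normal_p_subgroup_def p_group_def order_def)
  have Ss: "subgroup S G" using S by (simp add: sylow_subgroup_def)
  obtain m where m: "order G = card S * m" "\<not> p dvd m" using sylow_index[OF fin p S] .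
  obtain g where g: "g \<in> carrier G" and *: "\<And>y. y \<in> N \<Longrightarrow> inv g \<otimes> y \<otimes> g \<in> S"
    using p_subgroup_conj_into[OF fin p sub k Ss m] by blast
  have xc: "x \<in> carrier G" using x sub subgroup.mem_carrier by fast
  have "g \<otimes> x \<otimes> inv g \<in> N" using conj_closed_iff(1)[OF Nn g xc] x by simp
  then show "x \<in> S" using *[of "g \<otimes> x \<otimes> inv g"] conj_inverse[OF g xc] by simp
qed

lemma (in group) card_subgroup_dvd:
  assumes "subgroup H G" "subgroup K G" "H \<subseteq> K"
  shows "card H dvd card K"
proof -
  have "card (rcosets\<^bsub>G\<lparr>carrier := K\<rparr>\<^esub> H) * card H = card K"
    using group.lagrange[OF subgroup_imp_group[OF assms(2)] subgroup_incl[OF assms]]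
    by (simp add: order_def)
  then show ?thesis by (metis dvd_triv_right)
qed

text \<open>The intersection of S and L is a Sylow subgroup of L: by the second isomorphism theorem
  its index in L equals that of S in LS, which divides the index of S in G.\<close>

lemma (in group) sylow_Int_normal:
  assumes fin: "finite (carrier G)" and p: "Factorial_Ring.prime p" and S: "sylow_subgroup p G S"
    and L: "L \<lhd> G"
  obtains m where "card L = card (S \<inter> L) * m" "\<not> p dvd m"
proof -
  have Ss: "subgroup S G" using S by (simp add: sylow_subgroup_def)
  have Ls: "subgroup L G" using L by (rule normal_imp_subgroup)
  obtain m where m: "order G = card S * m" "\<not> p dvd m" using sylow_index[OF fin p S] .
  interpret I: second_isomorphism_grp L G S
    using L Ss by (simp add: second_isomorphism_grp_def second_isomorphism_grp_axioms_def)
  let ?Q = "(G\<lparr>carrier := L <#> S\<rparr>) Mod L"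
  let ?R = "(G\<lparr>carrier := S\<rparr>) Mod (L \<inter> S)"
  have q: "order ?Q = order ?R"
    using I.normal_intersection_quotient_isom unfolding iso_def order_def
    by (auto dest: bij_betw_same_card)
  have sub: "subgroup (L <#> S) G" using I.normal_set_mult_subgroup .
  have "subgroup L (G\<lparr>carrier := L <#> S\<rparr>)"
    using Ls sub I.H_contained_in_set_mult by (auto intro: subgroup_incl)
  from group.lagrange[OF subgroup_imp_group[OF sub] this]
  have 1: "card (L <#> S) = order ?Q * card L" by (simp add: order_def FactGroup_def)
  have "subgroup (L \<inter> S) (G\<lparr>carrier := S\<rparr>)"
    using Ls Ss by (auto intro: subgroup_incl subgroups_Inter_pair)
  from group.lagrange[OF subgroup_imp_group[OF Ss] this]
  have 2: "card S = order ?R * card (L \<inter> S)" by (simp add: order_def FactGroup_def)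
  obtain r where r: "order G = card (L <#> S) * r"
    using card_subgroup_dvd[OF sub subgroup_self subgroup.subset[OF sub]] by (auto simp: order_def)
  have "card S \<noteq> 0" using S p by (auto simp: sylow_subgroup_def)
  then have "order ?R \<noteq> 0" unfolding 2 by simp
  moreover have "order ?R * (card L * r) = order ?R * (card (L \<inter> S) * m)"
    using m(1) r 1 2 q by (simp add: mult_ac)
  ultimately have eq: "card L * r = card (L \<inter> S) * m" by simp
  obtain m' where m': "card L = card (L \<inter> S) * m'"
    using card_subgroup_dvd[OF subgroups_Inter_pair[OF Ls Ss] Ls Int_lower1] by (rule dvdE)
  have "card L \<noteq> 0"
    using Ls fin by (metis card_eq_0_iff empty_iff finite_subset subgroup.one_closed subgroup.subset)
  then have "m' * r = m" using eq by (simp add: m')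
  then have "\<not> p dvd m'" using m(2) by auto
  moreover have "card L = card (S \<inter> L) * m'" using m' by (simp only: Int_commute)
  ultimately show thesis using that by blast
qed

text \<open>With T the intersection of S and L, the index of C in L being a power of p gives L = CT.
  Sylow's theorem in L brings the g-conjugate of T back into T by some element of L, and its factor
  in C is the required c.\<close>

lemma (in group) frattini_argument:
  assumes fin: "finite (carrier G)" and p: "Factorial_Ring.prime p" and S: "sylow_subgroup p G S"
    and C: "C \<lhd> G" and L: "L \<lhd> G" and CL: "C \<subseteq> L" and card_L: "card L = card C * p ^ k"
    and g: "g \<in> carrier G"
  obtains c n where "c \<in> C" "n \<in> carrier G" "g = c \<otimes> n" "\<And>x. x \<in> S \<inter> L \<Longrightarrow> n \<otimes> x \<otimes> inv n \<in> S \<inter> L"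
proof -
  let ?T = "S \<inter> L"
  have Ss: "subgroup S G" using S by (simp add: sylow_subgroup_def)
  have Ls: "subgroup L G" and Cs: "subgroup C G" using L C by (auto intro: normal_imp_subgroup)
  have Ts: "subgroup ?T G" using subgroups_Inter_pair[OF Ss Ls] .
  have car: "x \<in> carrier G" if "x \<in> L" for x using that Ls subgroup.mem_carrier by fast
  obtain m where m: "card L = card ?T * m" "\<not> p dvd m" using sylow_Int_normal[OF fin p S L] .
  have finL: "finite L" using fin Ls subgroup.subset finite_subset by metis
  have L0: "card L \<noteq> 0" using finL subgroup.one_closed[OF Ls] by (auto simp: card_eq_0_iff)
  interpret I: second_isomorphism_grp C G ?T
    using C Ts by (simp add: second_isomorphism_grp_def second_isomorphism_grp_axioms_def)
  have sub: "subgroup (C <#> ?T) G" using I.normal_set_mult_subgroup .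
  have CTL: "C <#> ?T \<subseteq> L"
    using CL subgroup.m_closed[OF Ls] by (auto simp: set_mult_def)
  \<comment> \<open>The index a of CT in L divides both m, which is prime to p, and
    \<open>p ^ k\<close>, the index of C in L. Hence a = 1.\<close>
  have L_eq: "C <#> ?T = L"
  proof -
    obtain a where a: "card L = card (C <#> ?T) * a" using card_subgroup_dvd[OF sub Ls CTL] by auto
    obtain b where b: "card (C <#> ?T) = card ?T * b"
      using card_subgroup_dvd[OF Ts sub I.S_contained_in_set_mult] by auto
    obtain c where c: "card (C <#> ?T) = card C * c"
      using card_subgroup_dvd[OF Cs sub I.H_contained_in_set_mult] by auto
    have "m = b * a" using L0 m(1) a b by auto
    then have "\<not> p dvd a" using m(2) by auto
    moreover have "p ^ k = c * a" using L0 card_L a c by auto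
    then obtain i where "a = p ^ i" using divides_primepow_nat[OF p] by (metis dvd_triv_right)
    ultimately have "a = 1" by (cases i) auto
    then show ?thesis using a CTL finL by (simp add: card_subset_eq)
  qed
  let ?P = "(\<lambda>x. g \<otimes> x \<otimes> inv g) ` ?T"
  have "?P = g <# ?T #> inv g" by (auto simp: l_coset_def r_coset_def)
  then have Ps: "subgroup ?P G"
    using subgroup_conjugation_is_surj2[OF g Ts] by simp
  have PL: "?P \<subseteq> L" using L g by (auto simp: normal_inv_iff)
  have inj: "inj_on (\<lambda>x. g \<otimes> x \<otimes> inv g) ?T"
    using conj_inverse[OF g] car by (intro inj_on_inverseI[where g = "\<lambda>x. inv g \<otimes> x \<otimes> g"]) auto
  have "card ?T dvd card S" using card_subgroup_dvd[OF Ts Ss] by simp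
  then obtain j where j: "card ?P = p ^ j"
    using divides_primepow_nat[OF p] S card_image[OF inj] by (auto simp: sylow_subgroup_def)
  let ?K = "G\<lparr>carrier := L\<rparr>"
  interpret K: group ?K using subgroup_imp_group[OF Ls] .
  \<comment> \<open>The conjugate of T by g stays in L by normality, so Sylow conjugation can be
    carried out inside L.\<close>
  obtain l where l: "l \<in> L" and "\<forall>x\<in>?P. inv\<^bsub>?K\<^esub> l \<otimes> x \<otimes> l \<in> ?T"
    using K.p_subgroup_conj_into[OF _ p subgroup_incl[OF Ps Ls PL] j subgroup_incl[OF Ts Ls]] m finL
    by (auto simp: order_def)
  then have *: "inv l \<otimes> (g \<otimes> x \<otimes> inv g) \<otimes> l \<in> ?T" if "x \<in> ?T" for x
    using that Ls by (auto simp: m_inv_consistent)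
  have "l \<in> C <#> ?T" using l L_eq by simp
  then obtain c t where ct: "c \<in> C" "t \<in> ?T" "l = c \<otimes> t" unfolding set_mult_def by blast
  have tc: "t \<in> carrier G" "c \<in> carrier G"
    using ct subgroup.mem_carrier[OF Ts] subgroup.mem_carrier[OF Cs] by auto
  let ?n = "inv c \<otimes> g"
  have "?n \<otimes> x \<otimes> inv ?n \<in> ?T" if x: "x \<in> ?T" for x
  proof -
    have xc: "x \<in> carrier G" using x car by auto
    have "t \<otimes> (inv l \<otimes> (g \<otimes> x \<otimes> inv g) \<otimes> l) \<otimes> inv t \<in> ?T"
      by (intro subgroup.m_closed[OF Ts] subgroup.m_inv_closed[OF Ts] ct(2) *[OF x])
    moreover have "t \<otimes> (inv l \<otimes> (g \<otimes> x \<otimes> inv g) \<otimes> l) \<otimes> inv t = ?n \<otimes> x \<otimes> inv ?n"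
      unfolding ct(3) using tc xc g by (simp add: inv_mult_group m_assoc cancel_inv)
    ultimately show ?thesis by simp
  qed
  moreover have "g = c \<otimes> ?n" using tc g by (simp add: cancel_inv)
  ultimately show thesis using that[of c ?n] ct tc g by blast
qed


section \<open>The conjugation action: its kernel, the preimage of O_p, and quadratic
  elements\<close>

lemma (in group) conj_action_group_hom:
  assumes "P \<lhd> G"
  shows "group_hom G (AutoGroup (G\<lparr>carrier := P\<rparr>)) (conj_action G P)"
  using conj_action_hom[OF assms] group.AutoGroup[OF subgroup_imp_group[OF normal_imp_subgroup[OF assms]]]
  by (simp add: group_hom_def group_hom_axioms_def)

lemma (in group) kernel_conj_action:
  assumes P: "P \<lhd> G"
  shows "kernel G (AutoGroup (G\<lparr>carrier := P\<rparr>)) (conj_action G P) = centralizer G P"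
proof -
  have car: "w \<in> P \<Longrightarrow> w \<in> carrier G" for w
    using normal_imp_subgroup[OF P] subgroup.mem_carrier by fast
  have one: "\<one>\<^bsub>AutoGroup (G\<lparr>carrier := P\<rparr>)\<^esub> = (\<lambda>w\<in>P. w)"
    by (simp add: AutoGroup_def BijGroup_def)
  have "conj_action G P g = (\<lambda>w\<in>P. w) \<longleftrightarrow> (\<forall>h\<in>P. g \<otimes> h = h \<otimes> g)" if g: "g \<in> carrier G" for g
  proof -
    have eq: "g \<otimes> w \<otimes> inv g = w \<longleftrightarrow> g \<otimes> w = w \<otimes> g" if "w \<in> P" for w
      using inv_solve_right'[of w "g \<otimes> w" g] g car[OF that] by simp
    have "conj_action G P g = (\<lambda>w\<in>P. w) \<longleftrightarrow> (\<forall>w\<in>P. g \<otimes> w \<otimes> inv g = w)"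
      unfolding conj_action_def by (metis (no_types, lifting) restrict_apply' restrict_ext)
    also have "\<dots> \<longleftrightarrow> (\<forall>w\<in>P. g \<otimes> w = w \<otimes> g)" using eq by (rule ball_cong[OF refl])
    finally show ?thesis .
  qed
  then show ?thesis
    unfolding kernel_def centralizer_def one by (rule Collect_cong[OF conj_cong[OF refl]])
qed

lemma (in group) centralizer_normal:
  assumes "P \<lhd> G"
  shows "centralizer G P \<lhd> G"
  using group_hom.normal_kernel[OF conj_action_group_hom[OF assms]] kernel_conj_action[OF assms]
  by simp

text \<open>L is the union of the cosets that make up O_p(G/C_G(P)). The correspondence theorem
  gives normality, and Lagrange turns the order of O_p into the index of C_G(P) in L, as the
  Frattini argument requires.\<close>

lemma (in group) p_core_conj_action:
  assumes fin: "finite (carrier G)" and p: "Factorial_Ring.prime p" and P: "P \<lhd> G"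
  defines "L \<equiv> p_core_action p G (G\<lparr>carrier := P\<rparr>) (conj_action G P)"
  shows "L \<lhd> G" and "centralizer G P \<subseteq> L" and "\<exists>k. card L = card (centralizer G P) * p ^ k"
proof -
  let ?C = "centralizer G P"
  interpret C: normal ?C G using centralizer_normal[OF P] .
  interpret Q: group "G Mod ?C" using C.factorgroup_is_group .
  let ?M = "p_core p (G Mod ?C)"
  have "finite (carrier (G Mod ?C))" using fin by (simp add: carrier_FactGroup)
  then have M: "normal_p_subgroup p (G Mod ?C) ?M" using Q.p_core_greatest(1) p by blast
  then have Mn: "?M \<lhd> G Mod ?C" and Ms: "subgroup ?M (G Mod ?C)"
    by (auto simp: normal_p_subgroup_def intro: normal_imp_subgroup)
  have L: "L = \<Union>?M"
    unfolding L_def p_core_action_def kernel_conj_action[OF P]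
    using C.factgroup_subgroup_union_char[OF Ms] by simp
  show Ln: "L \<lhd> G" using C.factgroup_subgroup_union_normal[OF Mn] L by simp
  show CL: "?C \<subseteq> L" using subgroup.one_closed[OF Ms] L by auto
  have Ls: "subgroup L G" using Ln by (rule normal_imp_subgroup)
  obtain k where "card ?M = p ^ k" using M by (auto simp: normal_p_subgroup_def p_group_def order_def)
  moreover have "card ?M * card ?C = card L"
    using group.lagrange[OF subgroup_imp_group[OF Ls] subgroup_incl[OF C.subgroup_axioms Ls CL]]
      C.factgroup_subgroup_union_factor[OF Ms] L by (simp add: order_def)
  ultimately show "\<exists>k. card L = card ?C * p ^ k" by (metis mult.commute)
qed

text \<open>Since P normalizes A, we have [P, x] \<le> A and so [P, x, x] \<le> [A, A] = 1.\<close>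
lemma (in group) normalized_abelian_acts_quadratically:
  assumes P: "P \<lhd> G" and A: "subgroup A G" and comm: "\<And>x y. x \<in> A \<Longrightarrow> y \<in> A \<Longrightarrow> x \<otimes> y = y \<otimes> x"
    and norm: "\<And>b a. b \<in> P \<Longrightarrow> a \<in> A \<Longrightarrow> b \<otimes> a \<otimes> inv b \<in> A" and x: "x \<in> A"
  shows "acts_quadratically G (G\<lparr>carrier := P\<rparr>) (conj_action G P) x"
proof -
  let ?K = "G\<lparr>carrier := P\<rparr>"
  let ?c = "action_commutator G ?K (conj_action G P)"
  have Ps: "subgroup P G" using P by (rule normal_imp_subgroup)
  interpret K: group ?K using subgroup_imp_group[OF Ps] .
  have car: "w \<in> P \<Longrightarrow> w \<in> carrier G" for w using Ps subgroup.mem_carrier by fast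
  have carA: "a \<in> A \<Longrightarrow> a \<in> carrier G" for a using A subgroup.mem_carrier by fast
  \<comment> \<open>\<open>conj_action\<close> is a left action, so at \<open>inv x\<close> it sends
    w to x^-1 w x and the generators are the commutators [w, x].\<close>
  have c_eq: "?c W x = generate ?K ((\<lambda>w. inv w \<otimes> (inv x \<otimes> w \<otimes> x)) ` W)" if W: "W \<subseteq> P" for W
  proof -
    have "inv\<^bsub>?K\<^esub> w \<otimes>\<^bsub>?K\<^esub> conj_action G P (inv x) w = inv w \<otimes> (inv x \<otimes> w \<otimes> x)" if "w \<in> W" for w
      using that W Ps carA[OF x] by (auto simp: conj_action_def)
    then show ?thesis
      unfolding action_commutator_def Setcompr_eq_image by (metis (no_types, lifting) image_cong)
  qed
  have AP: "subgroup (A \<inter> P) ?K"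
    using A Ps by (auto intro: subgroup_incl subgroups_Inter_pair)
  \<comment> \<open>Regroup [w, x] as (w^-1 x^-1 w) x: the first factor is in A because P normalizes
    A.\<close>
  have in_A: "inv w \<otimes> (inv x \<otimes> w \<otimes> x) \<in> A \<inter> P" if w: "w \<in> P" for w
  proof
    have "inv w \<otimes> inv x \<otimes> inv (inv w) \<in> A"
      using norm subgroup.m_inv_closed[OF Ps w] subgroup.m_inv_closed[OF A x] by blast
    then have "inv w \<otimes> inv x \<otimes> w \<otimes> x \<in> A" using x A car[OF w] by (simp add: subgroup.m_closed)
    then show "inv w \<otimes> (inv x \<otimes> w \<otimes> x) \<in> A"
      using car[OF w] carA[OF x] by (simp add: m_assoc)
    show "inv w \<otimes> (inv x \<otimes> w \<otimes> x) \<in> P"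
      using w conj_closed_iff(2)[OF P carA[OF x] car[OF w]] Ps
      by (simp add: subgroup.m_closed subgroup.m_inv_closed)
  qed
  have 1: "?c P x \<subseteq> A \<inter> P"
    unfolding c_eq[OF order_refl] by (rule K.generate_subgroup_incl[OF _ AP]) (use in_A in auto)
  \<comment> \<open>Ensures that the image of [P, x] computed below is exactly the trivial set and
    not empty.\<close>
  have "\<one> \<in> ?c P x"
    unfolding c_eq[OF order_refl] using generate.one[of ?K] by simp
  moreover have "inv w \<otimes> (inv x \<otimes> w \<otimes> x) = \<one>" if "w \<in> ?c P x" for w
  proof -
    have w: "w \<in> A" using that 1 by auto
    have "inv x \<otimes> w \<otimes> x = w"
      using comm[OF w x] carA[OF w] carA[OF x] by (simp add: m_assoc cancel_inv)
    then show ?thesis using carA[OF w] by simp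
  qed
  ultimately have "(\<lambda>w. inv w \<otimes> (inv x \<otimes> w \<otimes> x)) ` ?c P x = {\<one>}"
    by (intro equalityI image_subsetI) (auto simp: image_iff)
  then have "?c (?c P x) x = generate ?K {\<one>}"
    using 1 by (subst c_eq) auto
  then show ?thesis
    using K.generate_one by (simp add: acts_quadratically_def)
qed

section \<open>Commutators modulo a normal subgroup\<close>

text \<open>The identity [xz, y] = [x, y]^z [z, y].\<close>

lemma (in group) commutator_mult_left:
  assumes "x \<in> carrier G" "y \<in> carrier G" "z \<in> carrier G"
  shows "inv (x \<otimes> z) \<otimes> inv y \<otimes> (x \<otimes> z) \<otimes> y =
    inv z \<otimes> (inv x \<otimes> inv y \<otimes> x \<otimes> y) \<otimes> z \<otimes> (inv z \<otimes> inv y \<otimes> z \<otimes> y)"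
  using assms by (simp add: inv_mult_group m_assoc cancel_inv)

lemma (in group) commutator_inv_left:
  assumes "x \<in> carrier G" "y \<in> carrier G"
  shows "inv (inv x) \<otimes> inv y \<otimes> inv x \<otimes> y = x \<otimes> inv (inv x \<otimes> inv y \<otimes> x \<otimes> y) \<otimes> inv x"
  using assms by (simp add: inv_mult_group m_assoc cancel_inv)

lemma (in group) commutator_mod_sym:
  assumes "subgroup N G" "x \<in> carrier G" "y \<in> carrier G" "inv x \<otimes> inv y \<otimes> x \<otimes> y \<in> N"
  shows "inv y \<otimes> inv x \<otimes> y \<otimes> x \<in> N"
  using subgroup.m_inv_closed[OF assms(1,4)] assms(2,3) by (simp add: inv_mult_group m_assoc)

text \<open>This set is the preimage of the centralizer of YN/N in G/N. The identities for products
  and inverses in the left argument give closure without passing to the quotient.\<close>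

lemma (in group) commutator_mod_subgroup:
  assumes N: "N \<lhd> G" and Y: "Y \<subseteq> carrier G"
  shows "subgroup {x \<in> carrier G. \<forall>y\<in>Y. inv x \<otimes> inv y \<otimes> x \<otimes> y \<in> N} G"
proof (rule subgroupI)
  have Ns: "subgroup N G" using N by (rule normal_imp_subgroup)
  show "{x \<in> carrier G. \<forall>y\<in>Y. inv x \<otimes> inv y \<otimes> x \<otimes> y \<in> N} \<noteq> {}"
    using Y subgroup.one_closed[OF Ns] by (auto intro!: exI[of _ \<one>])
  fix a assume a: "a \<in> {x \<in> carrier G. \<forall>y\<in>Y. inv x \<otimes> inv y \<otimes> x \<otimes> y \<in> N}"
  have "inv (inv a) \<otimes> inv y \<otimes> inv a \<otimes> y \<in> N" if y: "y \<in> Y" for y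
  proof -
    have c: "a \<in> carrier G" "y \<in> carrier G" using a y Y by auto
    show ?thesis
      unfolding commutator_inv_left[OF c]
      using a y N Ns by (simp add: normal_inv_iff subgroup.m_inv_closed)
  qed
  then show "inv a \<in> {x \<in> carrier G. \<forall>y\<in>Y. inv x \<otimes> inv y \<otimes> x \<otimes> y \<in> N}"
    using a by auto
  fix b assume b: "b \<in> {x \<in> carrier G. \<forall>y\<in>Y. inv x \<otimes> inv y \<otimes> x \<otimes> y \<in> N}"
  have "inv (a \<otimes> b) \<otimes> inv y \<otimes> (a \<otimes> b) \<otimes> y \<in> N" if y: "y \<in> Y" for y
  proof -
    have c: "a \<in> carrier G" "b \<in> carrier G" "y \<in> carrier G" using a b y Y by auto
    show ?thesis
      unfolding commutator_mult_left[OF c(1,3,2)]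
      by (rule subgroup.m_closed[OF Ns])
        (use a b y c in \<open>simp_all add: conj_closed_iff(2)[OF N]\<close>)
  qed
  then show "a \<otimes> b \<in> {x \<in> carrier G. \<forall>y\<in>Y. inv x \<otimes> inv y \<otimes> x \<otimes> y \<in> N}"
    using a b by auto
qed auto

text \<open>Conjugation by g carries [x, g^-1 y g] to [g x g^-1, y]. With this normality, a
  commutator relation checked on a set passes to its normal closure.\<close>

lemma (in group) commutator_mod_normal:
  assumes N: "N \<lhd> G" and Y: "Y \<lhd> G"
  shows "{x \<in> carrier G. \<forall>y\<in>Y. inv x \<otimes> inv y \<otimes> x \<otimes> y \<in> N} \<lhd> G"
proof -
  have car: "w \<in> Y \<Longrightarrow> w \<in> carrier G" for w
    using normal_imp_subgroup[OF Y] subgroup.mem_carrier by fast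
  have "inv (g \<otimes> x \<otimes> inv g) \<otimes> inv y \<otimes> (g \<otimes> x \<otimes> inv g) \<otimes> y \<in> N"
    if g: "g \<in> carrier G" and x: "x \<in> carrier G" and y: "y \<in> Y"
      and *: "\<forall>y\<in>Y. inv x \<otimes> inv y \<otimes> x \<otimes> y \<in> N" for g x y
  proof -
    let ?y = "inv g \<otimes> y \<otimes> g"
    have "?y \<in> Y" using conj_closed_iff(2)[OF Y g car[OF y]] y by simp
    then have "g \<otimes> (inv x \<otimes> inv ?y \<otimes> x \<otimes> ?y) \<otimes> inv g \<in> N"
      using * N g by (simp add: normal_inv_iff)
    moreover have "g \<otimes> (inv x \<otimes> inv ?y \<otimes> x \<otimes> ?y) \<otimes> inv g =
        inv (g \<otimes> x \<otimes> inv g) \<otimes> inv y \<otimes> (g \<otimes> x \<otimes> inv g) \<otimes> y"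
      using g x car[OF y] by (simp add: inv_mult_group m_assoc cancel_inv)
    ultimately show ?thesis by simp
  qed
  then show ?thesis
    using commutator_mod_subgroup[OF N, of Y] car by (simp add: normal_inv_iff subset_iff)
qed

lemma (in group) commutator_subgroup_incl:
  assumes "subgroup N G" "\<And>x y. x \<in> H \<Longrightarrow> y \<in> K \<Longrightarrow> inv x \<otimes> inv y \<otimes> x \<otimes> y \<in> N"
  shows "commutator_subgroup G H K \<subseteq> N"
  unfolding commutator_subgroup_def using assms(2) by (intro generate_subgroup_incl[OF _ assms(1)]) auto

text \<open>A maximal proper normal subgroup C omits some Z in F, so G = CZ and G/C is abelian.\<close>
lemma (in group) derived_neq_self:
  assumes fin: "finite (carrier G)" and ne: "carrier G \<noteq> {\<one>}"
    and F: "\<And>Z. Z \<in> F \<Longrightarrow> Z \<lhd> G" "\<And>Z x y. Z \<in> F \<Longrightarrow> x \<in> Z \<Longrightarrow> y \<in> Z \<Longrightarrow> x \<otimes> y = y \<otimes> x"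
    and gen: "\<And>N. N \<lhd> G \<Longrightarrow> \<Union>F \<subseteq> N \<Longrightarrow> N = carrier G"
  shows "derived G (carrier G) \<noteq> carrier G"
proof -
  let ?M = "{N. N \<lhd> G \<and> N \<noteq> carrier G}"
  have "?M \<subseteq> Pow (carrier G)" by (auto dest!: normal_imp_subgroup subgroup.subset)
  then have "finite ?M" using fin finite_subset by blast
  moreover have "{\<one>} \<in> ?M" using one_is_normal ne by auto
  ultimately obtain C where C: "C \<lhd> G" "C \<noteq> carrier G"
    and max: "\<And>N. N \<lhd> G \<Longrightarrow> N \<noteq> carrier G \<Longrightarrow> C \<subseteq> N \<Longrightarrow> N = C"
    using finite_has_maximal[of ?M] by (metis (mono_tags, lifting) empty_iff mem_Collect_eq)
  have Cs: "subgroup C G" using C(1) by (rule normal_imp_subgroup)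
  obtain Z where Z: "Z \<in> F" "\<not> Z \<subseteq> C" using gen[OF C(1)] C(2) by blast
  have Zs: "subgroup Z G" using F(1)[OF Z(1)] by (rule normal_imp_subgroup)
  have carC: "w \<in> C \<Longrightarrow> w \<in> carrier G" for w using Cs subgroup.mem_carrier by fast
  have carZ: "w \<in> Z \<Longrightarrow> w \<in> carrier G" for w using Zs subgroup.mem_carrier by fast
  interpret I: second_isomorphism_grp C G Z
    using C Zs by (simp add: second_isomorphism_grp_def second_isomorphism_grp_axioms_def)
  have CZ: "C <#> Z = carrier G"
    using max[OF normal_subgroup_set_mult_closed[OF C(1) F(1)[OF Z(1)]]]
      I.H_contained_in_set_mult I.S_contained_in_set_mult Z(2) by blast
  have all: "T = carrier G" if T: "subgroup T G" and "C \<subseteq> T" "Z \<subseteq> T" for T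
  proof -
    have "C <#> Z \<subseteq> T" using that subgroup.m_closed[OF T] by (auto simp: set_mult_def)
    then show ?thesis using CZ subgroup.subset[OF T] by auto
  qed
  have comm_C: "inv c \<otimes> inv y \<otimes> c \<otimes> y \<in> C" if c: "c \<in> C" and y: "y \<in> carrier G" for c y
  proof -
    have "inv c \<otimes> (inv y \<otimes> c \<otimes> y) \<in> C"
      using c Cs conj_closed_iff(2)[OF C(1) y carC[OF c]]
      by (simp add: subgroup.m_closed subgroup.m_inv_closed)
    then show ?thesis using y carC[OF c] by (simp add: m_assoc)
  qed
  have comm_Z: "inv x \<otimes> inv y \<otimes> x \<otimes> y \<in> C" if x: "x \<in> Z" and y: "y \<in> Z" for x y
  proof -
    have "inv x \<otimes> inv y \<otimes> x \<otimes> y = inv x \<otimes> inv y \<otimes> (y \<otimes> x)"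
      using F(2)[OF Z(1) x y] carZ[OF x] carZ[OF y] by (simp add: m_assoc)
    also have "\<dots> = \<one>" using carZ[OF x] carZ[OF y] by (simp add: m_assoc cancel_inv)
    finally show ?thesis using subgroup.one_closed[OF Cs] by simp
  qed
  \<comment> \<open>First pass: the elements commuting with Z modulo C form a subgroup containing C
    and Z, hence all of G.\<close>
  have "{x \<in> carrier G. \<forall>y\<in>Z. inv x \<otimes> inv y \<otimes> x \<otimes> y \<in> C} = carrier G" (is "?U = _")
    using all[OF commutator_mod_subgroup[OF C(1)], of Z] comm_C comm_Z carC carZ
    by (auto simp: subset_iff)
  then have *: "inv x \<otimes> inv y \<otimes> x \<otimes> y \<in> C" if "x \<in> carrier G" "y \<in> Z" for x y
    using that by blast
  have "inv z \<otimes> inv y \<otimes> z \<otimes> y \<in> C" if "z \<in> Z" "y \<in> carrier G" for z y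
    using commutator_mod_sym[OF Cs that(2) carZ[OF that(1)] *[OF that(2,1)]] .
  \<comment> \<open>Second pass: by symmetry Z commutes with G modulo C, and so does C, hence G
    commutes with itself modulo C.\<close>
  then have "{x \<in> carrier G. \<forall>y\<in>carrier G. inv x \<otimes> inv y \<otimes> x \<otimes> y \<in> C} = carrier G"
    by (intro all[OF commutator_mod_subgroup[OF C(1) order_refl]]) (use comm_C carC carZ in auto)
  then have "commutator_subgroup G (carrier G) (carrier G) \<subseteq> C"
    by (intro commutator_subgroup_incl[OF Cs]) blast
  then show ?thesis
    using commutator_subgroup_self[OF subgroup_self] C(2) subgroup.subset[OF Cs] by auto
qed


section \<open>Normal closures of abelian subgroups: proper derived subgroup and class at most
  2\<close>

text \<open>The hypothesis \<open>gen\<close> says that B lies in the normal closure of Z in G, so the conjugates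
  of Z, which are abelian and normal in B, generate B.\<close>
lemma (in group) derived_neq_self_of_conjugates:
  assumes fin: "finite (carrier G)" and B: "B \<lhd> G" "B \<noteq> {\<one>}"
    and Z: "subgroup Z G" "Z \<subseteq> B" "\<And>x y. x \<in> Z \<Longrightarrow> y \<in> Z \<Longrightarrow> x \<otimes> y = y \<otimes> x"
      "\<And>b z. b \<in> B \<Longrightarrow> z \<in> Z \<Longrightarrow> b \<otimes> z \<otimes> inv b \<in> Z"
    and gen: "\<And>N. N \<lhd> G \<Longrightarrow> Z \<subseteq> N \<Longrightarrow> B \<subseteq> N"
  shows "derived G B \<noteq> B"
proof -
  let ?K = "G\<lparr>carrier := B\<rparr>"
  let ?F = "(\<lambda>g. (\<lambda>x. g \<otimes> x \<otimes> inv g) ` Z) ` carrier G"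
  have Bs: "subgroup B G" using B(1) by (rule normal_imp_subgroup)
  interpret K: group ?K using subgroup_imp_group[OF Bs] .
  have carB: "w \<in> B \<Longrightarrow> w \<in> carrier G" for w using Bs subgroup.mem_carrier by fast
  have car: "w \<in> Z \<Longrightarrow> w \<in> carrier G" for w using Z(1) subgroup.mem_carrier by fast
  \<comment> \<open>Conjugating gxg^-1 by b amounts to conjugating x by g^-1 b g, which is again in
    B, and then by g. Hence every conjugate of Z is normal in B.\<close>
  have conj_eq: "b \<otimes> (g \<otimes> x \<otimes> inv g) \<otimes> inv b =
      g \<otimes> ((inv g \<otimes> b \<otimes> g) \<otimes> x \<otimes> inv (inv g \<otimes> b \<otimes> g)) \<otimes> inv g"
    if "g \<in> carrier G" "b \<in> carrier G" "x \<in> carrier G" for g b x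
    using that by (simp add: inv_mult_group m_assoc cancel_inv)
  have "derived ?K (carrier ?K) \<noteq> carrier ?K"
  proof (rule K.derived_neq_self[where F = ?F])
    show "finite (carrier ?K)"
      using fin finite_subset[OF subgroup.subset[OF Bs]] by simp
    show "carrier ?K \<noteq> {\<one>\<^bsub>?K\<^esub>}" using B(2) by simp
  next
    fix Y assume "Y \<in> ?F"
    then obtain g where g: "g \<in> carrier G" and Y: "Y = (\<lambda>x. g \<otimes> x \<otimes> inv g) ` Z" by blast
    have "Y = g <# Z #> inv g" using Y by (auto simp: l_coset_def r_coset_def)
    then have Ys: "subgroup Y G" using subgroup_conjugation_is_surj2[OF g Z(1)] by simp
    have "Y \<subseteq> B" using Y Z(2) B(1) g by (auto simp: normal_inv_iff)
    then have "subgroup Y ?K" using subgroup_incl[OF Ys Bs] by simp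
    moreover have "b \<otimes> y \<otimes> inv b \<in> Y" if b: "b \<in> B" and y: "y \<in> Y" for b y
    proof -
      obtain x where x: "x \<in> Z" "y = g \<otimes> x \<otimes> inv g" using y Y by blast
      have "inv g \<otimes> b \<otimes> g \<in> B" using conj_closed_iff(2)[OF B(1) g carB[OF b]] b by simp
      from Z(4)[OF this x(1)] show ?thesis
        unfolding x(2) conj_eq[OF g carB[OF b] car[OF x(1)]] Y by (rule imageI)
    qed
    ultimately show "Y \<lhd> ?K" using Bs by (auto simp: K.normal_inv_iff)
    show "x \<otimes>\<^bsub>?K\<^esub> y = y \<otimes>\<^bsub>?K\<^esub> x" if xy: "x \<in> Y" "y \<in> Y" for x y
    proof -
      obtain u v where uv: "u \<in> Z" "x = g \<otimes> u \<otimes> inv g" "v \<in> Z" "y = g \<otimes> v \<otimes> inv g"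
        using xy Y by blast
      then show ?thesis
        using Z(3)[of u v] g car by (simp flip: conj_mult)
    qed
  next
    fix N assume N: "N \<lhd> ?K" "\<Union>?F \<subseteq> N"
    have Ns: "subgroup N G" using incl_subgroup[OF Bs normal_imp_subgroup[OF N(1)]] .
    \<comment> \<open>N is normal only in B, so \<open>gen\<close> does not apply to it. Its normal
      core in G is normal in G and contains Z because N contains all conjugates of Z.\<close>
    let ?M = "{x \<in> carrier G. \<forall>g\<in>carrier G. g \<otimes> x \<otimes> inv g \<in> N}"
    have "subgroup ?M G"
    proof (rule subgroupI)
      show "?M \<noteq> {}" using subgroup.one_closed[OF Ns] by (auto intro!: exI[of _ \<one>])
      fix a assume a: "a \<in> ?M"
      have "g \<otimes> inv a \<otimes> inv g \<in> N" if "g \<in> carrier G" for g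
      proof -
        have "inv (g \<otimes> a \<otimes> inv g) \<in> N" using a that Ns by (simp add: subgroup.m_inv_closed)
        then show ?thesis using a that by (simp add: inv_mult_group m_assoc)
      qed
      then show "inv a \<in> ?M" using a by simp
      fix b assume b: "b \<in> ?M"
      show "a \<otimes> b \<in> ?M"
        using a b Ns by (simp add: conj_mult subgroup.m_closed)
    qed auto
    moreover have "g \<otimes> (h \<otimes> x \<otimes> inv h) \<otimes> inv g \<in> N" if "x \<in> ?M" "g \<in> carrier G" "h \<in> carrier G" for g h x
    proof -
      have "(g \<otimes> h) \<otimes> x \<otimes> inv (g \<otimes> h) \<in> N" using that by blast
      then show ?thesis using that by (simp add: inv_mult_group m_assoc)
    qed
    ultimately have "?M \<lhd> G" by (simp add: normal_inv_iff)
    moreover have "Z \<subseteq> ?M" using N(2) car by blast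
    ultimately have "B \<subseteq> ?M" by (rule gen)
    moreover have "?M \<subseteq> N"
    proof
      fix x assume "x \<in> ?M"
      then have "x \<in> carrier G" "\<one> \<otimes> x \<otimes> inv \<one> \<in> N" by blast+
      then show "x \<in> N" by simp
    qed
    ultimately show "N = carrier ?K"
      using subgroup.subset[OF normal_imp_subgroup[OF N(1)]] by auto
  qed
  then show ?thesis using derived_consistent[OF order_refl Bs] by simp
qed

text \<open>Put K = Z \<inter> B'. Then [Z \<inter> B, B] \<le> K and [Z \<inter> B, K] = 1. Both relations are inherited by the
  normal closure B of Z \<inter> B because K is normal, so B' \<le> K and [B', B] = 1.\<close>
lemma (in group) class_le_2_of_conjugates:
  assumes B: "B \<lhd> G"
    and Z: "subgroup Z G" "\<And>x y. x \<in> Z \<Longrightarrow> y \<in> Z \<Longrightarrow> x \<otimes> y = y \<otimes> x"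
      "\<And>b z. b \<in> B \<Longrightarrow> z \<in> Z \<Longrightarrow> b \<otimes> z \<otimes> inv b \<in> Z"
    and gen: "\<And>N. N \<lhd> G \<Longrightarrow> Z \<inter> B \<subseteq> N \<Longrightarrow> B \<subseteq> N"
    and K: "Z \<inter> derived G B \<lhd> G"
  shows "commutator_subgroup G B B \<subseteq> Z" and "nilpotency_class_le G B 2"
proof -
  let ?K = "Z \<inter> derived G B"
  have Bs: "subgroup B G" using B by (rule normal_imp_subgroup)
  have Ks: "subgroup ?K G" using K by (rule normal_imp_subgroup)
  have carB: "w \<in> B \<Longrightarrow> w \<in> carrier G" for w using Bs subgroup.mem_carrier by fast
  have car: "w \<in> Z \<Longrightarrow> w \<in> carrier G" for w using Z(1) subgroup.mem_carrier by fast
  have der: "commutator_subgroup G B B = derived G B" using commutator_subgroup_self[OF Bs] .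
  have comm: "inv z \<otimes> inv b \<otimes> z \<otimes> b \<in> ?K" if z: "z \<in> Z \<inter> B" and b: "b \<in> B" for z b
  proof
    have "inv b \<otimes> z \<otimes> b \<in> Z"
      using Z(3)[of "inv b" z] z subgroup.m_inv_closed[OF Bs b] carB[OF b] by simp
    then have "inv z \<otimes> (inv b \<otimes> z \<otimes> b) \<in> Z"
      using z Z(1) by (simp add: subgroup.m_closed subgroup.m_inv_closed)
    then show "inv z \<otimes> inv b \<otimes> z \<otimes> b \<in> Z" using z carB b by (simp add: m_assoc)
    show "inv z \<otimes> inv b \<otimes> z \<otimes> b \<in> derived G B"
      unfolding der[symmetric] commutator_subgroup_def using z b by (intro generate.incl) blast
  qed
  have "B \<subseteq> {x \<in> carrier G. \<forall>y\<in>B. inv x \<otimes> inv y \<otimes> x \<otimes> y \<in> ?K}"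
    by (intro gen commutator_mod_normal[OF K B]) (use comm carB in blast)
  then have "commutator_subgroup G B B \<subseteq> ?K"
    by (intro commutator_subgroup_incl[OF Ks]) blast
  then show *: "commutator_subgroup G B B \<subseteq> Z" by blast
  have der_car: "derived G B \<subseteq> carrier G" using derived_in_carrier subgroup.subset[OF Bs] by blast
  have "B \<subseteq> {x \<in> carrier G. \<forall>y\<in>derived G B. inv x \<otimes> inv y \<otimes> x \<otimes> y \<in> {\<one>}}"
  proof (intro gen commutator_mod_normal[OF one_is_normal derived_is_normal[OF B]])
    have "inv z \<otimes> inv y \<otimes> z \<otimes> y = \<one>" if "z \<in> Z" "y \<in> derived G B" for z y
    proof -
      have y: "y \<in> Z" using * that(2) der by blast
      have "inv z \<otimes> inv y \<otimes> z \<otimes> y = inv z \<otimes> inv y \<otimes> (y \<otimes> z)"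
        using Z(2)[OF that(1) y] car[OF y] car[OF that(1)] by (simp add: m_assoc)
      then show ?thesis using car[OF y] car[OF that(1)] by (simp add: m_assoc cancel_inv)
    qed
    then show "Z \<inter> B \<subseteq> {x \<in> carrier G. \<forall>y\<in>derived G B. inv x \<otimes> inv y \<otimes> x \<otimes> y \<in> {\<one>}}"
      using car by blast
  qed
  \<comment> \<open>Swaps the arguments, since the next term of \<open>lower_central\<close> is
    [B', B] with B' on the left.\<close>
  then have "inv y \<otimes> inv x \<otimes> y \<otimes> x \<in> {\<one>}" if "x \<in> B" "y \<in> derived G B" for x y
    using that der_car commutator_mod_sym[OF triv_subgroup, of x y] by blast
  then have "commutator_subgroup G (derived G B) B \<subseteq> {\<one>}"
    by (intro commutator_subgroup_incl[OF triv_subgroup]) blast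
  moreover have "\<one> \<in> commutator_subgroup G (derived G B) B"
    unfolding commutator_subgroup_def by (rule generate.one)
  \<comment> \<open>As \<open>lower_central\<close> is indexed from 0, its term at 2 is [[B, B],
    B].\<close>
  ultimately show "nilpotency_class_le G B 2"
    using der by (auto simp: nilpotency_class_le_def numeral_2_eq_2)
qed


section \<open>Completeness and conjugation-invariant intersections\<close>

lemma (in group) normalizerD:
  assumes "A \<subseteq> carrier G" "b \<in> normalizer G A" "a \<in> A"
  shows "b \<otimes> a \<otimes> inv b \<in> A"
proof -
  have "b <# A #> inv b = A"
    using assms by (simp add: normalizer_def stabilizer_def)
  moreover have "b \<otimes> a \<otimes> inv b \<in> b <# A #> inv b"
    using assms(3) by (auto simp: l_coset_def r_coset_def)
  ultimately show ?thesis by simp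
qed

lemma (in group) conjugate_iso:
  assumes A: "subgroup A G" and g: "g \<in> carrier G"
  shows "G\<lparr>carrier := (\<lambda>x. g \<otimes> x \<otimes> inv g) ` A\<rparr> \<cong> G\<lparr>carrier := A\<rparr>"
proof -
  have car: "x \<in> A \<Longrightarrow> x \<in> carrier G" for x using A subgroup.mem_carrier by fast
  have "inj_on (\<lambda>x. g \<otimes> x \<otimes> inv g) A"
    using conj_inverse[OF g] car by (intro inj_on_inverseI[where g = "\<lambda>x. inv g \<otimes> x \<otimes> g"]) auto
  then have "(\<lambda>x. g \<otimes> x \<otimes> inv g) \<in>
      iso (G\<lparr>carrier := A\<rparr>) (G\<lparr>carrier := (\<lambda>x. g \<otimes> x \<otimes> inv g) ` A\<rparr>)"
    using g car by (auto simp: iso_def hom_def bij_betw_def conj_mult)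
  then show ?thesis
    using group.iso_sym[OF subgroup_imp_group[OF A]] by (auto simp: is_iso_def)
qed

text \<open>A conjugate is isomorphic to A, so completeness applies as soon as it stays inside
  D.\<close>

lemma (in group) complete_conj_mem:
  assumes com: "complete_in G \<A> D" and D: "subgroup D G" and A: "A \<in> \<A>" "subgroup A G"
    and g: "g \<in> carrier G" and sub: "(\<lambda>x. g \<otimes> x \<otimes> inv g) ` A \<subseteq> D"
  shows "(\<lambda>x. g \<otimes> x \<otimes> inv g) ` A \<in> \<A>"
proof -
  have "(\<lambda>x. g \<otimes> x \<otimes> inv g) ` A = g <# A #> inv g" by (auto simp: l_coset_def r_coset_def)
  then have "subgroup ((\<lambda>x. g \<otimes> x \<otimes> inv g) ` A) G"
    using subgroup_conjugation_is_surj2[OF g A(2)] by simp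
  then have "subgroup ((\<lambda>x. g \<otimes> x \<otimes> inv g) ` A) (G\<lparr>carrier := D\<rparr>)"
    using subgroup_incl D sub by blast
  then show ?thesis
    using com conjugate_iso[OF A(2) g] A(1) unfolding complete_in_def by blast
qed

text \<open>Conjugation by g sends members of the family inside E to members inside E. So x lies in
  the conjugate of each such A, and conjugating back puts it in A; this is why the conclusion
  concerns \<open>inv g\<close>. It serves for E = D and for the part of D in a normal
  subgroup.\<close>

lemma (in group) complete_Inter_conj_closed:
  assumes com: "complete_in G \<A> D" and D: "subgroup D G"
    and sub: "\<And>A. A \<in> \<A> \<Longrightarrow> subgroup A G"
    and E: "E \<subseteq> D" and g: "g \<in> carrier G" and E_conj: "\<And>d. d \<in> E \<Longrightarrow> g \<otimes> d \<otimes> inv g \<in> E"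
    and x: "x \<in> \<Inter>{A \<in> \<A>. A \<subseteq> E}"
  shows "inv g \<otimes> x \<otimes> g \<in> \<Inter>{A \<in> \<A>. A \<subseteq> E}"
proof (rule InterI)
  fix A assume "A \<in> {A \<in> \<A>. A \<subseteq> E}"
  then have A: "A \<in> \<A>" "A \<subseteq> E" by auto
  let ?A = "(\<lambda>x. g \<otimes> x \<otimes> inv g) ` A"
  have "?A \<subseteq> E" using A(2) E_conj by auto
  moreover from this have "?A \<in> \<A>"
    using E by (intro complete_conj_mem[OF com D A(1) sub[OF A(1)] g]) auto
  ultimately have "x \<in> ?A" using x by blast
  then obtain a where a: "a \<in> A" "x = g \<otimes> a \<otimes> inv g" by blast
  then have "a \<in> carrier G" using sub[OF A(1)] subgroup.mem_carrier by fast
  then show "inv g \<otimes> x \<otimes> g \<in> A" using a conj_inverse[OF g] by simp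
qed

section \<open>Induction over normal p-subgroups and passage to O_p(G)\<close>

lemma (in group) inter_family_normal:
  assumes p: "Factorial_Ring.prime p" and fin: "finite (carrier G)" and S: "sylow_subgroup p G S"
    and cent: "centralizer G (p_core p G) \<subseteq> p_core p G"
    and stable: "\<And>P. normal_p_subgroup p G P \<Longrightarrow>
           p_stable_action p G (G\<lparr>carrier := P\<rparr>) (conj_action G P)"
    and closed: "strongly_closed G S D"
    and abelian: "\<And>A. A \<in> \<A> \<Longrightarrow> subgroup A (G\<lparr>carrier := D\<rparr>) \<and> comm_group (G\<lparr>carrier := A\<rparr>)"
    and complete: "complete_in G \<A> D"
    and replacement: "satisfies_replacement G \<A> S"
  shows "inter_family G \<A> \<lhd> G"
proof (cases "\<A> = {}")
  case True
  then show ?thesis using one_is_normal by (simp add: inter_family_def)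
next
  case False
  define Z where "Z = \<Inter>\<A>"
  have Ss: "subgroup S G" using S by (simp add: sylow_subgroup_def)
  have DnS: "D \<lhd> G\<lparr>carrier := S\<rparr>" using closed by (simp add: strongly_closed_def)
  have Ds: "subgroup D G" using incl_subgroup[OF Ss normal_imp_subgroup[OF DnS]] .
  have As: "subgroup A G" if "A \<in> \<A>" for A using incl_subgroup[OF Ds] abelian[OF that] by blast
  have A_comm: "x \<otimes> y = y \<otimes> x" if A: "A \<in> \<A>" and xy: "x \<in> A" "y \<in> A" for A x y
  proof -
    interpret A: comm_group "G\<lparr>carrier := A\<rparr>" using abelian[OF A] by blast
    show ?thesis using A.m_comm[of x y] xy by simp
  qed
  have AD: "A \<subseteq> D" if "A \<in> \<A>" for A using subgroup.subset[of A "G\<lparr>carrier := D\<rparr>"] abelian[OF that] by simp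
  have DS: "D \<subseteq> S" using subgroup.subset[OF normal_imp_subgroup[OF DnS]] by simp
  have carS: "x \<in> S \<Longrightarrow> x \<in> carrier G" for x using Ss subgroup.mem_carrier by fast
  have Zs: "subgroup Z G" unfolding Z_def using subgroups_Inter[of \<A>] As False by blast
  have ZS: "Z \<subseteq> S" using False AD DS unfolding Z_def by blast
  have Z_comm: "x \<otimes> y = y \<otimes> x" if "x \<in> Z" "y \<in> Z" for x y
    using that False A_comm unfolding Z_def by blast
  have D_conj: "s \<otimes> d \<otimes> inv s \<in> D" if "s \<in> S" "d \<in> D" for s d
    using group.normal_inv_iff[OF subgroup_imp_group[OF Ss], of D] DnS that Ss by auto
  \<comment> \<open>The case E = D, taken at \<open>inv s\<close> because the invariance lemma
    conjugates by the inverse.\<close>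
  have Z_conj: "s \<otimes> z \<otimes> inv s \<in> Z" if s: "s \<in> S" and z: "z \<in> Z" for s z
  proof -
    have eq: "{A \<in> \<A>. A \<subseteq> D} = \<A>" using AD by blast
    have s': "inv s \<in> S" using subgroup.m_inv_closed[OF Ss s] .
    show ?thesis
      using complete_Inter_conj_closed[OF complete Ds As order_refl inv_closed[OF carS[OF s]], of z]
        D_conj[OF s'] z carS[OF s] unfolding eq Z_def by simp
  qed
  \<comment> \<open>Used twice: for a member of the family acting on B, and for Z acting on
    O_p(G).\<close>
  have quadratic: "A \<subseteq> p_core_action p G (G\<lparr>carrier := P\<rparr>) (conj_action G P)"
    if P: "normal_p_subgroup p G P" and A: "subgroup A G"
      and comm: "\<And>x y. x \<in> A \<Longrightarrow> y \<in> A \<Longrightarrow> x \<otimes> y = y \<otimes> x"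
      and norm: "\<And>b a. b \<in> P \<Longrightarrow> a \<in> A \<Longrightarrow> b \<otimes> a \<otimes> inv b \<in> A" for P A
  proof
    fix x assume x: "x \<in> A"
    have Pn: "P \<lhd> G" using P by (simp add: normal_p_subgroup_def)
    have "acts_quadratically G (G\<lparr>carrier := P\<rparr>) (conj_action G P) x"
      by (rule normalized_abelian_acts_quadratically[OF Pn A comm norm x])
    then show "x \<in> p_core_action p G (G\<lparr>carrier := P\<rparr>) (conj_action G P)"
      using stable[OF P] subgroup.mem_carrier[OF A x] by (simp add: p_stable_action_def)
  qed
  \<comment> \<open>Strong induction on the order of B takes the place of a least
    counterexample.\<close>
  have main: "Z \<inter> B \<lhd> G" if "normal_p_subgroup p G B" for B
    using that
  proof (induction "card B" arbitrary: B rule: less_induct)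
    case less
    have Bn: "B \<lhd> G" using less.prems by (simp add: normal_p_subgroup_def)
    have Bs: "subgroup B G" using Bn by (rule normal_imp_subgroup)
    have BS: "B \<subseteq> S" using normal_p_subgroup_le_sylow[OF fin p S less.prems] .
    have finB: "finite B" using finite_subset[OF subgroup.subset[OF Bs] fin] .
    have IH: "Z \<inter> N \<lhd> G" if N: "N \<lhd> G" "N \<subseteq> B" "N \<noteq> B" for N
    proof (rule less.hyps)
      show "card N < card B" using N finB by (simp add: psubset_card_mono psubset_eq)
      have Ns: "subgroup N G" using N(1) by (rule normal_imp_subgroup)
      obtain k where "card B = p ^ k"
        using less.prems by (auto simp: normal_p_subgroup_def p_group_def order_def)
      then obtain i where "card N = p ^ i"
        using card_subgroup_dvd[OF Ns Bs N(2)] divides_primepow_nat[OF p] by metis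
      then show "normal_p_subgroup p G N"
        using N subgroup_imp_group[OF Ns] finite_subset[OF N(2) finB]
        by (auto simp: normal_p_subgroup_def p_group_def order_def)
    qed
    show ?case
    proof (rule ccontr)
      assume neg: "\<not> Z \<inter> B \<lhd> G"
      \<comment> \<open>Otherwise the intersection of N and B is a proper subgroup of B with the
        same intersection with Z, and \<open>IH\<close> makes that normal in G.\<close>
      have gen: "B \<subseteq> N" if N: "N \<lhd> G" "Z \<inter> B \<subseteq> N" for N
      proof (rule ccontr)
        assume "\<not> B \<subseteq> N"
        then have "Z \<inter> (N \<inter> B) \<lhd> G"
          using normal_subgroup_intersect[OF N(1) Bn] by (intro IH) auto
        moreover have "Z \<inter> (N \<inter> B) = Z \<inter> B" using N(2) by blast
        ultimately show False using neg by simp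
      qed
      have "B \<noteq> {\<one>}"
      proof
        assume "B = {\<one>}"
        then have "Z \<inter> B = {\<one>}" using subgroup.one_closed[OF Zs] by auto
        then show False using neg one_is_normal by simp
      qed
      then have "derived G B \<noteq> B"
      proof (rule derived_neq_self_of_conjugates[OF fin Bn])
        show "subgroup (Z \<inter> B) G" using subgroups_Inter_pair[OF Zs Bs] .
        show "b \<otimes> z \<otimes> inv b \<in> Z \<inter> B" if "b \<in> B" "z \<in> Z \<inter> B" for b z
          using that Z_conj BS Bs by (auto simp: subgroup.m_closed subgroup.m_inv_closed)
      qed (use Z_comm gen in auto)
      then have "Z \<inter> derived G B \<lhd> G"
        using derived_is_normal[OF Bn] derived_incl[OF order_refl Bs] by (intro IH) auto
      from class_le_2_of_conjugates[OF Bn Zs Z_comm _ gen this] Z_conj BS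
      have der: "commutator_subgroup G B B \<subseteq> Z" and class2: "nilpotency_class_le G B 2" by blast+
      have "\<not> B \<subseteq> Z" using neg Bn by (auto simp: Int_absorb1)
      \<comment> \<open>Every member contains Z and hence [B, B], so any member omitting B meets the
        premise of replacement.\<close>
      then obtain A0 where "A0 \<in> \<A>" "\<not> B \<subseteq> A0" unfolding Z_def by blast
      moreover have "B \<lhd> G\<lparr>carrier := S\<rparr>" using normal_restrict_supergroup[OF Ss Bn BS] .
      ultimately obtain A where A: "A \<in> \<A>" "\<not> B \<subseteq> A" "B \<subseteq> normalizer G A"
        using replacement class2 der unfolding satisfies_replacement_def Z_def by blast
      let ?L = "p_core_action p G (G\<lparr>carrier := B\<rparr>) (conj_action G B)"
      let ?C = "centralizer G B"
      have AL: "A \<subseteq> ?L"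
        using A As[OF A(1)] normalizerD[OF subgroup.subset[OF As[OF A(1)]]]
        by (intro quadratic less.prems A_comm[OF A(1)]) auto
      obtain k where k: "card ?L = card ?C * p ^ k" using p_core_conj_action(3)[OF fin p Bn] by blast
      note L = p_core_conj_action(1)[OF fin p Bn] and CL = p_core_conj_action(2)[OF fin p Bn]
      have Cn: "?C \<lhd> G" using centralizer_normal[OF Bn] .
      let ?E = "D \<inter> ?L"
      let ?I = "\<Inter>{A \<in> \<A>. A \<subseteq> ?E}"
      have AE: "A \<in> {A \<in> \<A>. A \<subseteq> ?E}" using A(1) AL AD by blast
      have conj_I: "g \<otimes> x \<otimes> inv g \<in> ?I" if g: "g \<in> carrier G" and x: "x \<in> ?I \<inter> B" for g x
      proof -
        \<comment> \<open>factoring the inverse of g lets c act first, directly on the element x of B\<close>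
        obtain c n where cn: "c \<in> ?C" "n \<in> carrier G" "inv g = c \<otimes> n"
          and n: "\<And>y. y \<in> S \<inter> ?L \<Longrightarrow> n \<otimes> y \<otimes> inv n \<in> S \<inter> ?L"
          using frattini_argument[OF fin p S Cn L CL k inv_closed[OF g]] by blast
        have c: "c \<in> carrier G" and cx: "c \<otimes> x = x \<otimes> c"
          using cn(1) x by (auto simp: centralizer_def)
        have xc: "x \<in> carrier G" using x Bs subgroup.mem_carrier by fast
        have "g = inv (c \<otimes> n)" using cn(3) g by (metis inv_inv)
        then have "g \<otimes> x \<otimes> inv g = inv n \<otimes> (inv c \<otimes> (x \<otimes> c)) \<otimes> n"
          using cn c xc by (simp add: inv_mult_group m_assoc)
        also have "\<dots> = inv n \<otimes> x \<otimes> n"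
          unfolding cx[symmetric] using c xc by (simp add: cancel_inv)
        also have "\<dots> \<in> ?I"
        proof (rule complete_Inter_conj_closed[OF complete Ds As _ cn(2)])
          fix d assume d: "d \<in> ?E"
          then have nd: "n \<otimes> d \<otimes> inv n \<in> S \<inter> ?L" using n DS by blast
          \<comment> \<open>\<open>strongly_closed\<close> conjugates as g^-1 d g, so it is
            instantiated at g = n^-1.\<close>
          then have "inv (inv n) \<otimes> d \<otimes> inv n \<in> S" using cn(2) by simp
          then have "inv (inv n) \<otimes> d \<otimes> inv n \<in> D"
            using closed d inv_closed[OF cn(2)] unfolding strongly_closed_def by blast
          then show "n \<otimes> d \<otimes> inv n \<in> ?E" using nd cn(2) by simp
        qed (use x in auto)
        finally show ?thesis .
      qed
      have "subgroup ?I G" using subgroups_Inter[of "{A \<in> \<A>. A \<subseteq> ?E}"] As AE by blast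
      then have "?I \<inter> B \<lhd> G"
        using conj_I Bn subgroups_Inter_pair[OF _ Bs] by (simp add: normal_inv_iff)
      \<comment> \<open>\<open>?I\<close> is an intersection over a subfamily, hence contains Z;
        then \<open>gen\<close> forces B into \<open>?I\<close> and so into A.\<close>
      moreover have "Z \<inter> B \<subseteq> ?I \<inter> B" unfolding Z_def by blast
      ultimately have "B \<subseteq> ?I \<inter> B" by (rule gen)
      then show False using AE A(2) by blast
    qed
  qed
  let ?P = "p_core p G"
  let ?L = "p_core_action p G (G\<lparr>carrier := ?P\<rparr>) (conj_action G ?P)"
  have P: "normal_p_subgroup p G ?P" using p_core_greatest(1)[OF fin p] .
  then have Pn: "?P \<lhd> G" by (simp add: normal_p_subgroup_def)
  have "Z \<subseteq> ?L"
    using normal_p_subgroup_le_sylow[OF fin p S P] Z_conj by (intro quadratic[OF P Zs Z_comm]) auto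
  \<comment> \<open>C_G(O_p(G)) lies in O_p(G) and so has p-power order. As its index in
    \<open>?L\<close> is a power of p, \<open>?L\<close> is a normal p-subgroup.\<close>
  moreover have "?L \<subseteq> ?P"
  proof (rule p_core_greatest(2)[OF fin p])
    have Ls: "subgroup ?L G" using normal_imp_subgroup[OF p_core_conj_action(1)[OF fin p Pn]] .
    obtain k where k: "card ?L = card (centralizer G ?P) * p ^ k"
      using p_core_conj_action(3)[OF fin p Pn] by blast
    obtain j where "card ?P = p ^ j" using P by (auto simp: normal_p_subgroup_def p_group_def order_def)
    moreover have "card (centralizer G ?P) dvd card ?P"
      using card_subgroup_dvd cent normal_imp_subgroup centralizer_normal[OF Pn] Pn by blast
    ultimately obtain i where "card (centralizer G ?P) = p ^ i"
      using divides_primepow_nat[OF p] by metis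
    then have "card ?L = p ^ (i + k)" using k by (simp add: power_add)
    then show "normal_p_subgroup p G ?L"
      using p_core_conj_action(1)[OF fin p Pn] subgroup_imp_group[OF Ls]
        finite_subset[OF subgroup.subset[OF Ls] fin]
      by (auto simp: normal_p_subgroup_def p_group_def order_def)
  qed
  ultimately have "Z \<inter> ?P = Z" by blast
  then show ?thesis using main[OF P] False by (simp add: inter_family_def Z_def)
qed

theorem theorem1p6:
  fixes G :: "('a, 'b) monoid_scheme" and p :: nat and S D :: "'a set" and \<A> :: "'a set set"
  assumes "Factorial_Ring.prime p"
    and "group G" and "finite (carrier G)"
    and "p_group p (G\<lparr>carrier := S\<rparr>)"
    and "sylow_subgroup p G S"
    and "centralizer G (p_core p G) \<subseteq> p_core p G"
    and "\<And>P. normal_p_subgroup p G P \<Longrightarrow>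
           p_stable_action p G (G\<lparr>carrier := P\<rparr>) (conj_action G P)"
    and "D \<lhd> G\<lparr>carrier := S\<rparr>"
    and "strongly_closed G S D"
    and "\<And>A. A \<in> \<A> \<Longrightarrow> subgroup A (G\<lparr>carrier := D\<rparr>) \<and> comm_group (G\<lparr>carrier := A\<rparr>)"
    and "complete_in G \<A> D"
    and "satisfies_replacement G \<A> S"
  shows "inter_family G \<A> \<lhd> G"
  using group.inter_family_normal[OF assms(2,1,3,5,6,7,9,10,11,12)] .

end
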